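(* Let $d\ge 2$ be an integer, let $\beta\in[1,d)$ and let $Q=[0,1]^d\subset\mathbb{R}^d$. Then $$\sup_{t>0}\; t\,\mathcal{H}^{d-\beta}_\infty\big(\{|DI_1\chi_Q|>t\}\big)=+\infty .$$
   Context: $\chi_Q$ is the characteristic function of $Q$. The Riesz potential of order $1$ is $$I_1f(x)=\frac{1}{\gamma(1)}\int_{\mathbb{R}^d}\frac{f(y)}{|x-y|^{d-1}}\,dy,\qquad \gamma(1)=\frac{2\pi^{d/2}\Gamma(1/2)}{\Gamma((d-1)/2)},$$ and $DI_1\chi_Q$ is the gradient of $I_1\chi_Q$ (the vector Riesz transform of $\chi_Q$). The function $I_1\chi_Q$ is smooth on $\mathbb{R}^d\setminus\partial Q$, and $\{|DI_1\chi_Q|>t\}$ denotes the set of points $x\in\mathbb{R}^d\setminus\partial Q$ at which the Euclidean norm of this gradient exceeds $t$. For $0<s<d$, the Hausdorff content $\mathcal{H}^{s}_\infty$ is defined for compact $K\subset\mathbb{R}^d$ by $$\mathcal{H}^{s}_\infty(K)=\inf\Big\{\sum_{i=0}^\infty\omega_{s}r_i^{s}: K\subset\bigcup_{i=0}^\infty B(x_i,r_i)\Big\},\qquad \omega_s=\frac{\pi^{s/2}}{\Gamma(\frac s2+1)},$$ where $B(x,r)$ is the ball of center $x$ and radius $r$. It is extended to general sets by regularity: for open $U$, $\mathcal{H}^s_\infty(U)=\sup\{\mathcal{H}^s_\infty(K):K\subset U\text{ compact}\}$, and for arbitrary $A$, $\mathcal{H}^s_\infty(A)=\inf\{\mathcal{H}^s_\infty(U):U\supset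 A\text{ open}\}$. *)

theory Defs
  imports "HOL-Analysis.Analysis"
begin

definition riesz_gamma1 :: "nat \<Rightarrow> real" where
  "riesz_gamma1 d =
     2 * pi powr (real d / 2) * Gamma (1 / 2) / Gamma ((real d - 1) / 2)"

definition riesz_potential1 :: "('a::euclidean_space \<Rightarrow> real) \<Rightarrow> 'a \<Rightarrow> real" where
  "riesz_potential1 f x =
     1 / riesz_gamma1 DIM('a) *
       (LINT y|lebesgue. f y / norm (x - y) ^ (DIM('a) - 1))"

text \<open>The value of \<open>gradient f x\<close> is only meaningful where \<open>f\<close> is differentiable.\<close>

definition gradient :: "('a::real_inner \<Rightarrow> real) \<Rightarrow> 'a \<Rightarrow> 'a" where
  "gradient f x = (THE D. GDERIV f x :> D)"

lemma gradient_eqI: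
  assumes "GDERIV f x :> D"
  shows "gradient f x = D"
  unfolding gradient_def
proof (rule the_equality[of _ D])
  show "GDERIV f x :> D" by (fact assms)
next
  fix E assume "GDERIV f x :> E"
  then have "(\<lambda>h. inner h E) = (\<lambda>h. inner h D)"
    using assms unfolding gderiv_def by (rule has_derivative_unique)
  then show "E = D"
    by (metis inner_commute vector_eq_rdot)
qed

text \<open>
  The Hausdorff content is first defined on compact sets and then extended to open and to
  arbitrary sets by regularity. The normalisation \<open>\<pi> powr (s / 2) / Gamma (s / 2 + 1)\<close> is
  \<^const>\<open>unit_ball_vol\<close> at the real argument \<open>s\<close>. The covering balls are open; closed balls
  would give the same value for \<open>s > 0\<close>.
\<close>

definition hausdorff_content_compact :: "real \<Rightarrow> 'a::euclidean_space set \<Rightarrow> ennreal" where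
  "hausdorff_content_compact s K =
     Inf {(\<Sum>i. ennreal (unit_ball_vol s * r i powr s)) | (x :: nat \<Rightarrow> 'a) r.
           (\<forall>i. r i > 0) \<and> K \<subseteq> (\<Union>i. ball (x i) (r i))}"

definition hausdorff_content_open :: "real \<Rightarrow> 'a::euclidean_space set \<Rightarrow> ennreal" where
  "hausdorff_content_open s U =
     (SUP K\<in>{K. compact K \<and> K \<subseteq> U}. hausdorff_content_compact s K)"

definition hausdorff_content :: "real \<Rightarrow> 'a::euclidean_space set \<Rightarrow> ennreal" where
  "hausdorff_content s A =
     (INF U\<in>{U. open U \<and> A \<subseteq> U}. hausdorff_content_open s U)"

end

theory Submission
  imports Defs
begin

text \<open>
  The gradient of \<open>I\<^sub>1 \<chi>\<^sub>Q\<close> blows up logarithmically along the whole of each face of the cube, and a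
  face is \<open>(d - 1)\<close>-dimensional. Since \<open>\<beta> \<ge> 1\<close>, the content has dimension \<open>d - \<beta> \<le> d - 1\<close>, so it does
  not see that the superlevel sets get thinner and thinner in the normal direction: their
  contents stay above a positive constant \<open>c\<close> as \<open>t \<rightarrow> \<infinity>\<close>, and \<open>t\<close> times \<open>c\<close> is unbounded.

  The blow-up is measured from outside the cube, at a point \<open>x\<close> with \<open>x\<^sub>k = -\<epsilon>\<close> and all other
  coordinates in \<open>[1/4, 3/4]\<close>. There the kernel is smooth in a neighbourhood of \<open>x\<close>, uniformly for
  \<open>y \<in> Q\<close>, and the potential can be differentiated under the integral
  (\<open>GDERIV_riesz_potential1_indicator_cbox\<close>); moreover the \<open>k\<close>-th component of the gradient, a
  positive multiple of \<open>\<integral>\<^sub>Q (y\<^sub>k + \<epsilon>) / |x - y|\<^bsup>d+1\<^esup> dy\<close>, has a nonnegative integrand. For each scale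
  \<open>\<rho> = 4\<^bsup>-j\<^esup> \<ge> \<epsilon>\<close> there is a cube of side \<open>\<rho>\<close> in \<open>Q\<close> on which that integrand is at least a constant times
  \<open>\<rho>\<^bsup>-d\<^esup>\<close>, so each scale contributes at least the same amount and \<open>N\<close> scales, with \<open>\<epsilon> = 4\<^bsup>-N\<^esup>\<close>,
  contribute a multiple of \<open>N\<close> (\<open>near_face_integral_ge\<close>).

  Hence \<open>{|DI\<^sub>1 \<chi>\<^sub>Q| > t}\<close> contains a \<open>(d - 1)\<close>-dimensional cube of side \<open>1/2\<close> parallel to the face. Its
  content is bounded below, independently of \<open>\<epsilon>\<close>, by a volume comparison
  (\<open>hausdorff_content_compact_slice\<close>).
\<close>

section \<open>Hausdorff content of a codimension-one cube\<close>

lemma hausdorff_content_ge_compact: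
  assumes "compact K" "K \<subseteq> A"
  shows "hausdorff_content_compact s K \<le> hausdorff_content s A"
  unfolding hausdorff_content_def hausdorff_content_open_def
  using assms by (auto intro!: INF_greatest SUP_upper)

lemma emeasure_cbox_unit_side:
  fixes p q :: "real ^ 'd"
  assumes "q $ k = p $ k + 1" "\<And>i. i \<noteq> k \<Longrightarrow> q $ i = p $ i + l" "0 \<le> l"
  shows "emeasure lborel (cbox p q) = ennreal (l ^ (CARD('d) - 1))"
proof -
  have "p \<in> cbox p q"
    unfolding mem_box_cart using assms by (metis add_increasing2 order_refl zero_le_one)
  then have "measure lborel (cbox p q) = (\<Prod>i\<in>UNIV. q $ i - p $ i)"
    by (intro content_cbox_cart) auto
  also have "\<dots> = (q $ k - p $ k) * (\<Prod>i\<in>UNIV - {k}. q $ i - p $ i)"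
    by (rule prod.remove) auto
  also have "(\<Prod>i\<in>UNIV - {k}. q $ i - p $ i) = (\<Prod>i\<in>UNIV - {k}. l)"
    using assms by (intro prod.cong) auto
  finally have "measure lborel (cbox p q) = l ^ (CARD('d) - 1)"
    using assms by (simp add: card_Diff_singleton)
  then show ?thesis
    by (metis emeasure_eq_ennreal_measure emeasure_lborel_cbox_finite infinity_ennreal_def
        order_less_irrefl)
qed

text \<open>
  A ball of radius \<open>r\<close> meets the hyperplane in a set inside a \<open>(d - 1)\<close>-cube of side \<open>2r\<close>. Thickening
  the slice and these cubes to unit length in the normal direction turns \<open>(d - 1)\<close>-dimensional
  area into Lebesgue measure, so countable subadditivity gives \<open>l\<^bsup>d-1\<^esup> \<le> \<Sum> (2 r\<^sub>i)\<^bsup>d-1\<^esup>\<close>. For radii below \<open>1\<close>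
  the exponent may be lowered to \<open>s\<close>, which only increases the sum; a single radius of at least \<open>1\<close>
  already gives the bound, because \<open>l \<le> 2\<close>.
\<close>

lemma hausdorff_content_compact_slice:
  fixes p q :: "real ^ 'd"
  assumes s: "0 < s" "s \<le> real (CARD('d) - 1)"
    and q: "q $ k = p $ k" "\<And>i. i \<noteq> k \<Longrightarrow> q $ i = p $ i + l" and l: "0 \<le> l" "l \<le> 2"
  shows "ennreal (unit_ball_vol s * (l / 2) ^ (CARD('d) - 1))
           \<le> hausdorff_content_compact s (cbox p q)"
  unfolding hausdorff_content_compact_def
proof (rule Inf_greatest, clarify)
  let ?n = "CARD('d) - 1" and ?w = "unit_ball_vol s"
  fix x :: "nat \<Rightarrow> real ^ 'd" and r :: "nat \<Rightarrow> real"
  assume r: "\<forall>i. 0 < r i" and cover: "cbox p q \<subseteq> (\<Union>i. ball (x i) (r i))"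
  have w: "0 < ?w" using s by simp
  show "ennreal (?w * (l / 2) ^ ?n) \<le> (\<Sum>i. ennreal (?w * r i powr s))"
  proof (cases "\<exists>i. 1 \<le> r i")
    case True
    then obtain i where i: "1 \<le> r i" by blast
    have "(l / 2) ^ ?n \<le> 1" using l by (intro power_le_one) auto
    also have "1 \<le> r i powr s" using i s by (simp add: ge_one_powr_ge_zero)
    finally have "ennreal (?w * (l / 2) ^ ?n) \<le> ennreal (?w * r i powr s)"
      using w by (intro ennreal_leI mult_left_mono) auto
    also have "\<dots> = (\<Sum>j\<in>{i}. ennreal (?w * r j powr s))" by simp
    also have "\<dots> \<le> (\<Sum>j. ennreal (?w * r j powr s))"
      by (intro sum_le_suminf) auto
    finally show ?thesis .
  next
    case False
    \<comment> \<open>the slice and the cubes around the balls, thickened to unit length in direction \<open>k\<close>\<close>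
    define T where "T = cbox p (\<chi> i. if i = k then p $ k + 1 else q $ i)"
    define C where "C j = cbox (\<chi> i. if i = k then p $ k else x j $ i - r j)
                               (\<chi> i. if i = k then p $ k + 1 else x j $ i + r j)" for j
    have T: "emeasure lborel T = ennreal (l ^ ?n)"
      unfolding T_def using q l by (intro emeasure_cbox_unit_side[where k = k]) auto
    have C: "emeasure lborel (C j) = ennreal ((2 * r j) ^ ?n)" for j
      unfolding C_def using r less_imp_le by (intro emeasure_cbox_unit_side[where k = k]) auto
    have "T \<subseteq> (\<Union>j. C j)"
    proof
      fix y assume y: "y \<in> T"
      define z where "z = (\<chi> i. if i = k then p $ k else y $ i)"
      have "z \<in> cbox p q"
        using y q unfolding T_def z_def mem_box_cart by (auto split: if_splits)
      then obtain j where j: "dist (x j) z < r j" using cover by auto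
      have "x j $ i - r j \<le> y $ i \<and> y $ i \<le> x j $ i + r j" if "i \<noteq> k" for i
      proof -
        have "\<bar>x j $ i - y $ i\<bar> = \<bar>(x j - z) $ i\<bar>" using that by (simp add: z_def)
        also have "\<dots> \<le> dist (x j) z" unfolding dist_norm by (rule component_le_norm_cart)
        finally show ?thesis using j by (auto simp: abs_le_iff)
      qed
      moreover have "p $ k \<le> y $ k \<and> y $ k \<le> p $ k + 1"
        using y unfolding T_def mem_box_cart by (auto dest!: spec[of _ k])
      ultimately have "y \<in> C j" unfolding C_def mem_box_cart by auto
      then show "y \<in> (\<Union>j. C j)" by blast
    qed
    then have "emeasure lborel T \<le> emeasure lborel (\<Union>j. C j)"
      by (intro emeasure_mono) (auto simp: C_def)
    also have "\<dots> \<le> (\<Sum>j. emeasure lborel (C j))"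
      by (intro emeasure_subadditive_countably) (auto simp: C_def)
    finally have sub: "ennreal (l ^ ?n) \<le> (\<Sum>j. ennreal ((2 * r j) ^ ?n))"
      unfolding T C .
    have pw: "?w / 2 ^ ?n * (2 * r j) ^ ?n \<le> ?w * r j powr s" for j
    proof -
      have "r j ^ ?n = r j powr real ?n" using r by (intro powr_realpow[symmetric]) blast
      also have "\<dots> \<le> r j powr s"
        using False r s by (intro powr_mono') (auto simp: not_le less_imp_le)
      finally show ?thesis
        using w by (simp add: power_mult_distrib)
    qed
    have "ennreal (?w * (l / 2) ^ ?n) = ennreal (?w / 2 ^ ?n) * ennreal (l ^ ?n)"
      using w l by (simp add: power_divide flip: ennreal_mult)
    also have "\<dots> \<le> ennreal (?w / 2 ^ ?n) * (\<Sum>j. ennreal ((2 * r j) ^ ?n))"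
      by (intro mult_left_mono sub) auto
    also have "\<dots> = (\<Sum>j. ennreal (?w / 2 ^ ?n) * ennreal ((2 * r j) ^ ?n))"
      by simp
    also have "\<dots> = (\<Sum>j. ennreal (?w / 2 ^ ?n * (2 * r j) ^ ?n))"
      using w r by (intro suminf_cong ennreal_mult[symmetric]) (auto simp: less_imp_le)
    also have "\<dots> \<le> (\<Sum>j. ennreal (?w * r j powr s))"
      by (intro suminf_le ennreal_leI pw) auto
    finally show ?thesis .
  qed
qed

section \<open>The gradient of the potential away from the box\<close>

lemma has_derivative_inverse_norm_power:
  fixes z :: "'a::real_inner"
  assumes "z \<noteq> 0"
  shows "((\<lambda>z. 1 / norm z ^ n) has_derivative
           (\<lambda>h. h \<bullet> (- (real n / norm z ^ (n + 2)) *\<^sub>R z))) (at z within S)"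
proof (cases n)
  case (Suc m)
  have norm: "(norm has_derivative (\<lambda>h. h \<bullet> sgn z)) (at z within S)"
    using GDERIV_norm[OF assms] unfolding gderiv_def by (rule has_derivative_at_withinI)
  have "((\<lambda>z. 1 / norm z ^ n) has_derivative
      (\<lambda>h. - (real n * (h \<bullet> sgn z) * norm z ^ (n - 1)) / (norm z ^ n * norm z ^ n))) (at z within S)"
    using assms
    by (auto intro!: derivative_eq_intros norm simp: field_simps)
  moreover have "- (real n * (h \<bullet> sgn z) * norm z ^ (n - 1)) / (norm z ^ n * norm z ^ n)
      = h \<bullet> (- (real n / norm z ^ (n + 2)) *\<^sub>R z)" for h
    using assms Suc by (simp add: sgn_div_norm field_simps)
  ultimately show ?thesis by simp
qed simp

lemma riesz_potential1_indicator_cbox: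
  fixes x :: "'a::euclidean_space"
  assumes "x \<notin> cbox a b"
  shows "riesz_potential1 (indicator (cbox a b)) x =
    1 / riesz_gamma1 DIM('a) * integral (cbox a b) (\<lambda>y. 1 / norm (x - y) ^ (DIM('a) - 1))"
proof -
  have "(\<lambda>y. 1 / norm (x - y) ^ (DIM('a) - 1)) absolutely_integrable_on cbox a b"
    using assms by (intro absolutely_integrable_continuous continuous_intros) auto
  from set_lebesgue_integral_eq_integral(2)[OF this] show ?thesis
    unfolding riesz_potential1_def set_lebesgue_integral_def by simp
qed

text \<open>
  Near a point outside the box the kernel is continuously differentiable in \<open>x\<close>, jointly continuous
  with \<open>y\<close> in the box, so Leibniz' rule applies on a ball that avoids the box.
\<close>

lemma GDERIV_riesz_potential1_indicator_cbox:
  fixes x :: "'a::euclidean_space"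
  assumes x: "x \<notin> cbox a b"
  shows "GDERIV (riesz_potential1 (indicator (cbox a b))) x :>
    (real (DIM('a) - 1) / riesz_gamma1 DIM('a)) *\<^sub>R
      integral (cbox a b) (\<lambda>y. (1 / norm (x - y) ^ (DIM('a) + 1)) *\<^sub>R (y - x))"
proof -
  define n where "n = DIM('a) - 1"
  have n: "n + 2 = DIM('a) + 1" unfolding n_def using DIM_positive[where 'a = 'a] by simp
  define V where "V x y = (- (real n / norm (x - y) ^ (n + 2))) *\<^sub>R (x - y)" for x y :: 'a
  have "open (- cbox a b)" by auto
  then obtain e where e: "0 < e" "ball x e \<subseteq> - cbox a b"
    using x open_contains_ball by blast
  then have ne: "z \<noteq> y" if "z \<in> ball x e" "y \<in> cbox a b" for z y using that by auto
  have Vcont: "continuous_on (cbox a b) (V x)"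
    unfolding V_def using x by (intro continuous_intros) auto
  have "((\<lambda>z. integral (cbox a b) (\<lambda>y. 1 / norm (z - y) ^ n)) has_derivative
      integral (cbox a b) (\<lambda>y. blinfun_inner_left (V x y))) (at x within ball x e)"
  proof (rule leibniz_rule)
    show "((\<lambda>z. 1 / norm (z - y) ^ n) has_derivative blinfun_inner_left (V z y))
        (at z within ball x e)" if "z \<in> ball x e" "y \<in> cbox a b" for z y
    proof -
      have "((\<lambda>z. z - y) has_derivative (\<lambda>h. h)) (at z within ball x e)"
        by (auto intro!: derivative_eq_intros)
      from has_derivative_compose[OF this has_derivative_inverse_norm_power[of "z - y" n UNIV]]
      show ?thesis using ne[OF that] by (simp add: V_def)
    qed
    show "(\<lambda>y. 1 / norm (z - y) ^ n) integrable_on cbox a b" if "z \<in> ball x e" for z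
      using ne[OF that] by (intro integrable_continuous continuous_intros) auto
    show "continuous_on (ball x e \<times> cbox a b) (\<lambda>(z, y). blinfun_inner_left (V z y))"
      unfolding V_def split_def using ne by (intro continuous_intros) auto
  qed (use e in auto)
  moreover have "integral (cbox a b) (\<lambda>y. blinfun_inner_left (V x y))
      = blinfun_inner_left (integral (cbox a b) (V x))"
    using integral_linear[OF integrable_continuous[OF Vcont] bounded_linear_blinfun_inner_left]
    by (simp add: o_def)
  ultimately have "((\<lambda>z. integral (cbox a b) (\<lambda>y. 1 / norm (z - y) ^ n)) has_derivative
      (\<lambda>h. h \<bullet> integral (cbox a b) (V x))) (at x)"
    using e at_within_open[of x "ball x e"] by simp
  then have "((\<lambda>z. 1 / riesz_gamma1 DIM('a) * integral (cbox a b) (\<lambda>y. 1 / norm (z - y) ^ n))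
      has_derivative (\<lambda>h. 1 / riesz_gamma1 DIM('a) * (h \<bullet> integral (cbox a b) (V x)))) (at x)"
    by (rule has_derivative_mult_right)
  then have "(riesz_potential1 (indicator (cbox a b))
      has_derivative (\<lambda>h. 1 / riesz_gamma1 DIM('a) * (h \<bullet> integral (cbox a b) (V x)))) (at x)"
  proof (rule has_derivative_transform_within_open[where s = "ball x e"])
    show "1 / riesz_gamma1 DIM('a) * integral (cbox a b) (\<lambda>y. 1 / norm (z - y) ^ n)
        = riesz_potential1 (indicator (cbox a b)) z" if "z \<in> ball x e" for z
      using riesz_potential1_indicator_cbox[of z a b] that e n_def by auto
  qed (use e in auto)
  moreover have "integral (cbox a b) (V x) =
      real n *\<^sub>R integral (cbox a b) (\<lambda>y. (1 / norm (x - y) ^ (DIM('a) + 1)) *\<^sub>R (y - x))"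
    unfolding integral_cmul[symmetric] V_def n by (simp add: scaleR_right_diff_distrib)
  ultimately show ?thesis
    unfolding gderiv_def n_def by (simp add: mult.commute)
qed


section \<open>Logarithmic growth at a face of the unit cube\<close>

text \<open>
  The bound is logarithmic in the distance \<open>4\<^bsup>-N\<^esup>\<close> to the face. The cube \<open>A j\<close> has side \<open>\<rho> = 4\<^bsup>-j\<^esup>\<close>
  and lies at height between \<open>\<rho>\<close> and \<open>2\<rho>\<close> over the face. On it the numerator is at least \<open>\<rho>\<close> and,
  because \<open>4\<^bsup>-N\<^esup> \<le> \<rho>\<close>, the distance to \<open>x\<close> is at most \<open>3d\<rho>\<close>, so the integral over \<open>A j\<close> is at least
  \<open>\<rho>\<^bsup>d\<^esup> \<rho> / (3d\<rho>)\<^bsup>d+1\<^esup>\<close>, in which \<open>\<rho>\<close> cancels. The ratio \<open>4\<close> between the scales exceeds the ratio \<open>2\<close>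
  of the heights, which makes the closed cubes disjoint, and \<open>\<rho> \<le> 1/4\<close> keeps them inside the unit cube.
\<close>

lemma near_face_integral_ge:
  fixes x :: "real ^ 'd"
  assumes xk: "x $ k = - ((1 / 4) ^ N)"
    and xi: "\<And>i. i \<noteq> k \<Longrightarrow> 1 / 4 \<le> x $ i \<and> x $ i \<le> 3 / 4"
  shows "real N / (3 * real CARD('d)) ^ (CARD('d) + 1)
    \<le> integral (cbox 0 1) (\<lambda>y. (y - x) $ k / norm (x - y) ^ (CARD('d) + 1))"
proof -
  define d where "d = CARD('d)"
  have d: "0 < d" unfolding d_def by simp
  define f where "f y = (y - x) $ k / norm (x - y) ^ (d + 1)" for y
  define \<rho> where "\<rho> j = (1 / 4 :: real) ^ j" for j :: nat
  define p where "p j = (\<chi> i. if i = k then \<rho> j else x $ i)" for j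
  define A where "A j = cbox (p j) (p j + (\<chi> i. \<rho> j))" for j
  have \<rho>: "0 < \<rho> j" for j unfolding \<rho>_def by simp
  have \<rho>_mono: "\<rho> j \<le> \<rho> i" if "i \<le> j" for i j
    unfolding \<rho>_def using that by (intro power_decreasing) auto
  have A_k: "\<rho> j \<le> y $ k \<and> y $ k \<le> 2 * \<rho> j" if "y \<in> A j" for y j
    using that unfolding A_def p_def mem_box_cart by (auto dest!: spec[of _ k])
  have A_i: "x $ i \<le> y $ i \<and> y $ i \<le> x $ i + \<rho> j" if "y \<in> A j" "i \<noteq> k" for y i j
    using that unfolding A_def p_def mem_box_cart by (auto dest!: spec[of _ i])
  have x_notin: "x \<noteq> y" if "y \<in> cbox 0 1" for y
    using that xk \<rho>[of N] unfolding \<rho>_def mem_box_cart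
    by (metis neg_0_le_iff_le not_le zero_index)
  have cont: "continuous_on (cbox 0 1) f"
    unfolding f_def using x_notin by (intro continuous_intros) auto
  have A_sub: "A j \<subseteq> cbox 0 1" if "j \<in> {1..N}" for j
  proof
    fix y assume y: "y \<in> A j"
    have "\<rho> j \<le> 1 / 4" using \<rho>_mono[of 1 j] that by (simp add: \<rho>_def)
    then have "0 \<le> y $ i \<and> y $ i \<le> 1" for i
      using A_k[OF y] A_i[OF y, of i] xi[of i] \<rho>[of j] by (cases "i = k") auto
    then show "y \<in> cbox 0 1" by (simp add: mem_box_cart)
  qed
  have A_int: "f integrable_on A j" if "j \<in> {1..N}" for j
    using continuous_on_subset[OF cont A_sub[OF that]] unfolding A_def
    by (rule integrable_continuous)
  have A_ge: "1 / (3 * real d) ^ (d + 1) \<le> integral (A j) f" if j: "j \<in> {1..N}" for j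
  proof -
    let ?c = "\<rho> j / (3 * real d * \<rho> j) ^ (d + 1)"
    have lower: "?c \<le> f y" if y: "y \<in> A j" for y
    proof -
      have k: "\<rho> j \<le> (y - x) $ k" "(y - x) $ k \<le> 3 * \<rho> j"
        using A_k[OF y] xk[folded \<rho>_def] \<rho>[of N] \<rho>_mono[of j N] j by auto
      have "\<bar>(x - y) $ i\<bar> \<le> 3 * \<rho> j" for i
        using k A_i[OF y, of i] \<rho>[of j] by (cases "i = k") auto
      then have "(\<Sum>i\<in>UNIV. \<bar>(x - y) $ i\<bar>) \<le> real d * (3 * \<rho> j)"
        unfolding d_def by (intro sum_bounded_above) auto
      then have "norm (x - y) \<le> 3 * real d * \<rho> j"
        using norm_le_l1_cart[of "x - y"] by simp
      moreover have "0 < norm (x - y)"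
        using x_notin A_sub[OF j] y by auto
      ultimately show ?thesis
        unfolding f_def using k \<rho>[of j] by (intro frac_le power_mono zero_less_power) auto
    qed
    have "measure lborel (A j) = \<rho> j ^ d"
    proof -
      have "p j \<in> A j" unfolding A_def mem_box_cart using \<rho> less_imp_le by auto
      then show ?thesis
        unfolding A_def by (subst content_cbox_cart) (auto simp: d_def)
    qed
    then have "integral (A j) (\<lambda>_. ?c) = \<rho> j ^ d * ?c"
      unfolding A_def by simp
    also have "\<dots> = 1 / (3 * real d) ^ (d + 1)"
      using \<rho>[of j] d by (simp add: power_mult_distrib field_simps)
    finally have "1 / (3 * real d) ^ (d + 1) = integral (A j) (\<lambda>_. ?c)" ..
    also have "\<dots> \<le> integral (A j) f"
      using lower A_int[OF j] by (intro integral_le) (auto simp: A_def)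
    finally show ?thesis .
  qed
  have disj: "A i \<inter> A j = {}" if "i < j" for i j
  proof -
    have "\<rho> j \<le> \<rho> (Suc i)" using that by (intro \<rho>_mono) simp
    also have "\<rho> (Suc i) = \<rho> i / 4" by (simp add: \<rho>_def)
    finally have "2 * \<rho> j < \<rho> i" using \<rho>[of i] by simp
    then have "y \<notin> A j" if "y \<in> A i" for y
      using A_k[of y i] A_k[of y j] that by linarith
    then show ?thesis by blast
  qed
  have UN: "(f has_integral (\<Sum>j\<in>{1..N}. integral (A j) f)) (\<Union>j\<in>{1..N}. A j)"
  proof (rule has_integral_UN)
    show "pairwise (\<lambda>i j. negligible (A i \<inter> A j)) {1..N}"
      unfolding pairwise_def using disj by (metis Int_commute linorder_neqE_nat negligible_empty)
  qed (use A_int in auto)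
  have "real N / (3 * real d) ^ (d + 1) = (\<Sum>j\<in>{1..N}. 1 / (3 * real d) ^ (d + 1))"
    by simp
  also have "\<dots> \<le> (\<Sum>j\<in>{1..N}. integral (A j) f)"
    by (intro sum_mono A_ge)
  also have "\<dots> \<le> integral (cbox 0 1) f"
  proof (rule has_integral_subset_le[OF _ UN])
    show "(f has_integral integral (cbox 0 1) f) (cbox 0 1)"
      using cont by (intro integrable_integral integrable_continuous)
    show "\<forall>y\<in>cbox 0 1. 0 \<le> f y"
      using xk \<rho>[of N] unfolding f_def \<rho>_def
      by (auto simp: mem_box_cart intro!: divide_nonneg_nonneg add_nonneg_nonneg)
    show "(\<Union>j\<in>{1..N}. A j) \<subseteq> cbox 0 1"
      using A_sub by blast
  qed
  finally show ?thesis unfolding f_def d_def .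
qed

lemma riesz_gamma1_pos: "2 \<le> d \<Longrightarrow> 0 < riesz_gamma1 d"
  unfolding riesz_gamma1_def by (intro divide_pos_pos mult_pos_pos Gamma_real_pos) auto

lemma norm_gradient_near_face_ge:
  fixes x :: "real ^ 'd"
  assumes d: "2 \<le> CARD('d)" and xk: "x $ k = - ((1 / 4) ^ N)"
    and xi: "\<And>i. i \<noteq> k \<Longrightarrow> 1 / 4 \<le> x $ i \<and> x $ i \<le> 3 / 4"
  shows "real N * (real (CARD('d) - 1) / riesz_gamma1 CARD('d) / (3 * real CARD('d)) ^ (CARD('d) + 1))
    \<le> norm (gradient (riesz_potential1 (indicator (cbox 0 1))) x)"
proof -
  let ?c = "real (CARD('d) - 1) / riesz_gamma1 CARD('d)"
  let ?g = "\<lambda>y. (1 / norm (x - y) ^ (CARD('d) + 1)) *\<^sub>R (y - x)"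
  have "\<not> 0 \<le> x $ k" unfolding xk by (simp add: not_le)
  then have x: "x \<notin> cbox 0 1" unfolding mem_box_cart by (metis zero_index)
  then have int: "?g integrable_on cbox 0 1"
    by (intro integrable_continuous continuous_intros) auto
  have c: "0 \<le> ?c" using riesz_gamma1_pos[OF d] by simp
  have "real N * (?c / (3 * real CARD('d)) ^ (CARD('d) + 1))
      = ?c * (real N / (3 * real CARD('d)) ^ (CARD('d) + 1))" by simp
  also have "\<dots> \<le> ?c * integral (cbox 0 1) (\<lambda>y. (y - x) $ k / norm (x - y) ^ (CARD('d) + 1))"
    by (intro mult_left_mono near_face_integral_ge c) (use xk xi in auto)
  also have "\<dots> = (?c *\<^sub>R integral (cbox 0 1) ?g) $ k"
    using integral_component_eq_cart[OF int, of k] by (simp add: mult.commute)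
  also have "?c *\<^sub>R integral (cbox 0 1) ?g = gradient (riesz_potential1 (indicator (cbox 0 1))) x"
    using gradient_eqI[OF GDERIV_riesz_potential1_indicator_cbox[OF x]] by simp
  finally show ?thesis
    using component_le_norm_cart[of "gradient (riesz_potential1 (indicator (cbox 0 1))) x" k] by simp
qed

section \<open>Failure of the weak-type estimate\<close>

theorem lemma1p5:
  fixes \<beta> :: real and Q :: "(real ^ 'd) set"
  assumes d: "CARD('d) \<ge> 2"
    and \<beta>: "1 \<le> \<beta>" "\<beta> < real CARD('d)"
    and Q: "Q = {x. \<forall>i. 0 \<le> x $ i \<and> x $ i \<le> 1}"
  shows "(SUP t\<in>{0<..}. ennreal t *
            hausdorff_content (real CARD('d) - \<beta>)
              {x. x \<notin> frontier Q \<and>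
                  norm (gradient (riesz_potential1 (indicator Q)) x) > t}) = \<infinity>"
proof (rule ccontr)
  define s where "s = real CARD('d) - \<beta>"
  define L where "L t = {x. x \<notin> frontier Q \<and>
    norm (gradient (riesz_potential1 (indicator Q)) x) > t}" for t
  \<comment> \<open>the lower bound for the content of a slice of side \<open>1/2\<close>\<close>
  define c where "c = unit_ball_vol s * ((1 / 2) / 2) ^ (CARD('d) - 1)"
  have s: "0 < s" "s \<le> real (CARD('d) - 1)"
    using \<beta> d unfolding s_def by auto
  then have c: "0 < c" unfolding c_def by simp
  have Q_cbox: "Q = cbox 0 1" unfolding Q by (auto simp: mem_box_cart)
  fix k :: 'd
  have level: "ennreal c \<le> hausdorff_content s (L t)" for t
  proof -
    define a where "a = real (CARD('d) - 1) / riesz_gamma1 CARD('d)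
                          / (3 * real CARD('d)) ^ (CARD('d) + 1)"
    have "0 < a" unfolding a_def using riesz_gamma1_pos[OF d] d by simp
    then obtain N where N: "t < real N * a" using reals_Archimedean3 by blast
    define p :: "real ^ 'd" where "p = (\<chi> i. if i = k then - ((1 / 4) ^ N) else 1 / 4)"
    define q :: "real ^ 'd" where "q = (\<chi> i. if i = k then p $ k else p $ i + 1 / 2)"
    have "cbox p q \<subseteq> L t"
    proof
      fix x assume "x \<in> cbox p q"
      then have x: "p $ i \<le> x $ i" "x $ i \<le> q $ i" for i by (auto simp: mem_box_cart)
      have xk: "x $ k = - ((1 / 4) ^ N)" using x[of k] by (simp add: p_def q_def)
      have xi: "1 / 4 \<le> x $ i \<and> x $ i \<le> 3 / 4" if "i \<noteq> k" for i
        using x[of i] that by (simp add: p_def q_def)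
      have "\<not> 0 \<le> x $ k" unfolding xk by (simp add: not_le)
      then have "x \<notin> Q" unfolding Q by blast
      then have "x \<notin> frontier Q"
        using frontier_subset_closed[of Q] unfolding Q_cbox by auto
      then show "x \<in> L t"
        using norm_gradient_near_face_ge[OF d xk xi] N unfolding L_def Q_cbox a_def by simp
    qed
    then have "hausdorff_content_compact s (cbox p q) \<le> hausdorff_content s (L t)"
      by (intro hausdorff_content_ge_compact) auto
    moreover have "ennreal c \<le> hausdorff_content_compact s (cbox p q)"
      unfolding c_def by (rule hausdorff_content_compact_slice[OF s]) (auto simp: q_def)
    ultimately show ?thesis by (rule order_trans[rotated])
  qed
  let ?S = "SUP t\<in>{0<..}. ennreal t * hausdorff_content s (L t)"
  assume "(SUP t\<in>{0<..}. ennreal t * hausdorff_content (real CARD('d) - \<beta>)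
              {x. x \<notin> frontier Q \<and>
                  norm (gradient (riesz_potential1 (indicator Q)) x) > t}) \<noteq> \<infinity>"
  then have "?S \<noteq> top" unfolding s_def L_def by simp
  then obtain B where B: "0 \<le> B" "?S = ennreal B" by (cases ?S) auto
  \<comment> \<open>the level \<open>t = (B + 1) / c\<close> makes \<open>t\<close> times the content at least \<open>B + 1\<close>\<close>
  have "ennreal (B + 1) = ennreal ((B + 1) / c) * ennreal c"
    using B c by (simp flip: ennreal_mult)
  also have "\<dots> \<le> ennreal ((B + 1) / c) * hausdorff_content s (L ((B + 1) / c))"
    by (intro mult_left_mono level) auto
  also have "\<dots> \<le> ?S"
    using B c by (intro SUP_upper) auto
  finally show False using B by simp
qed

end
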